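(* (1) Every disk graph $G$ contains a balanced separator $S$ such that $G[S]$ is a linear disk graph. (2) Every linear disk graph $G$ contains a balanced separator $S$ which can be partitioned into sets $V_1,\dots,V_5$ such that $G[V_i]$ is a $\Delta$-disk graph for each $1\leq i\leq 4$ and $G[V_5]$ is a clique.
   Context: A disk graph is the intersection graph of a finite family of closed disks in the plane; such a family $\{D_v=D((x_v,y_v),r_v)\}$ (center $(x_v,y_v)$, radius $r_v$) is a disk representation. A subset $S\subseteq V(G)$ of an $n$-vertex graph is a balanced separator if $V(G)\setminus S$ can be partitioned into two sets $A,B$, each of size at most $\lceil n/2\rceil$, with no edge between $A$ and $B$. A disk graph is a linear disk graph if it has a disk representation and a line in the plane that intersects every disk of the representation. A disk graph is a $\Delta$-disk graph if it has a disk representation such that for every vertex $v$, $x_v>0$, $y_v>0$ and $\max(x_v,y_v)\leq r_v<\sqrt{x_v^2+y_v^2}$ (each disk meets both coordinate axes but does not contain the origin). *)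

theory Defs
  imports "HOL-Analysis.Analysis" "Graph_Theory.Graph_Theory"
begin

text \<open>
  A finite simple undirected graph is a pre-digraph satisfying \<^locale>\<open>graph\<close>: finite,
  loop-free, without parallel arcs, and with a symmetric adjacency relation, each edge being a
  pair of opposite arcs. The plane is \<^typ>\<open>real \<times> real\<close>, whose product metric is Euclidean.
\<close>

definition disk_representation ::
  "('a, 'b) pre_digraph \<Rightarrow> ('a \<Rightarrow> real) \<Rightarrow> ('a \<Rightarrow> real) \<Rightarrow> ('a \<Rightarrow> real) \<Rightarrow> bool" where
  "disk_representation G x y r \<longleftrightarrow>
     (\<forall>v\<in>verts G. 0 < r v) \<and>
     (\<forall>u\<in>verts G. \<forall>v\<in>verts G. u \<noteq> v \<longrightarrow>
        (u \<rightarrow>\<^bsub>G\<^esub> v \<longleftrightarrow> cball (x u, y u) (r u) \<inter> cball (x v, y v) (r v) \<noteq> {}))"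

definition disk_graph :: "('a, 'b) pre_digraph \<Rightarrow> bool" where
  "disk_graph G \<longleftrightarrow> graph G \<and> (\<exists>x y r. disk_representation G x y r)"

definition is_line :: "(real \<times> real) set \<Rightarrow> bool" where
  "is_line L \<longleftrightarrow> affine L \<and> aff_dim L = 1"

definition linear_disk_graph :: "('a, 'b) pre_digraph \<Rightarrow> bool" where
  "linear_disk_graph G \<longleftrightarrow> graph G \<and>
     (\<exists>x y r L. disk_representation G x y r \<and> is_line L \<and>
        (\<forall>v\<in>verts G. cball (x v, y v) (r v) \<inter> L \<noteq> {}))"

definition Delta_disk_graph :: "('a, 'b) pre_digraph \<Rightarrow> bool" where
  "Delta_disk_graph G \<longleftrightarrow> graph G \<and>
     (\<exists>x y r. disk_representation G x y r \<and>
        (\<forall>v\<in>verts G. 0 < x v \<and> 0 < y v \<and>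
           max (x v) (y v) \<le> r v \<and> r v < sqrt ((x v)\<^sup>2 + (y v)\<^sup>2)))"

definition balanced_separator :: "('a, 'b) pre_digraph \<Rightarrow> 'a set \<Rightarrow> bool" where
  "balanced_separator G S \<longleftrightarrow> S \<subseteq> verts G \<and>
     (\<exists>A B. A \<union> B = verts G - S \<and> A \<inter> B = {} \<and>
        int (card A) \<le> \<lceil>real (card (verts G)) / 2\<rceil> \<and>
        int (card B) \<le> \<lceil>real (card (verts G)) / 2\<rceil> \<and>
        (\<forall>a\<in>A. \<forall>b\<in>B. \<not> a \<rightarrow>\<^bsub>G\<^esub> b \<and> \<not> b \<rightarrow>\<^bsub>G\<^esub> a))"

end

theory Submission
  imports Defs
begin

text \<open>
  Project the disks orthogonally onto a line. Adjacent disks have overlapping projections, so the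
  disks whose projection contains a median of the left endpoints form a balanced separator; these
  are the disks meeting one fixed perpendicular line. Projecting a linear disk graph onto its
  stabbing line yields separating disks that meet both of two perpendicular lines, taken as
  coordinate axes. Those containing the origin pairwise intersect. The centre of any other one lies
  on neither axis, and within an open quadrant \<open>(x, y) \<mapsto> (\<bar>x\<bar>, \<bar>y\<bar>)\<close> is an isometry onto the
  positive quadrant.
\<close>

lemma sublevel_less_eq_sublevel_le:
  fixes f :: "'a \<Rightarrow> 'b::linorder"
  assumes "finite V" "{v \<in> V. f v < c} \<noteq> {}"
  obtains m where "m \<in> f ` V" "m < c" "{v \<in> V. f v < c} = {v \<in> V. f v \<le> m}"
proof -
  define m where "m = Max (f ` {v \<in> V. f v < c})"
  have "m \<in> f ` {v \<in> V. f v < c}"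
    unfolding m_def using assms by (intro Max_in) auto
  then have "m \<in> f ` V" "m < c"
    by auto
  moreover have "f v \<le> m" if "v \<in> V" "f v < c" for v
    unfolding m_def using assms(1) that by (intro Max_ge) auto
  with \<open>m < c\<close> have "{v \<in> V. f v < c} = {v \<in> V. f v \<le> m}"
    by auto
  ultimately show ?thesis
    by (rule that)
qed

lemma order_statistic_exists:
  fixes f :: "'a \<Rightarrow> 'b::linorder"
  assumes "0 < k" "k \<le> card V"
  obtains c where "card {v \<in> V. f v < c} < k" "k \<le> card {v \<in> V. f v \<le> c}"
proof -
  have "finite V" "V \<noteq> {}"
    using assms by (auto intro: card_ge_0_finite)
  define M where "M = {m \<in> f ` V. k \<le> card {v \<in> V. f v \<le> m}}"
  define c where "c = Min M"
  have "finite M"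
    using \<open>finite V\<close> by (simp add: M_def)
  have "{v \<in> V. f v \<le> Max (f ` V)} = V"
    using \<open>finite V\<close> by auto
  then have "Max (f ` V) \<in> M"
    using assms \<open>finite V\<close> \<open>V \<noteq> {}\<close> by (simp add: M_def)
  then have "c \<in> M"
    unfolding c_def using \<open>finite M\<close> by (intro Min_in) auto
  have "card {v \<in> V. f v < c} < k"
  proof (cases "{v \<in> V. f v < c} = {}")
    case True
    then show ?thesis
      using \<open>0 < k\<close> by (simp only: card.empty)
  next
    case False
    then obtain m where m: "m \<in> f ` V" "m < c" "{v \<in> V. f v < c} = {v \<in> V. f v \<le> m}"
      by (rule sublevel_less_eq_sublevel_le[OF \<open>finite V\<close>])
    from \<open>m < c\<close> have "m \<notin> M"
      using \<open>finite M\<close> by (auto simp: c_def dest: Min_le)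
    with m show ?thesis
      by (simp add: M_def)
  qed
  moreover have "k \<le> card {v \<in> V. f v \<le> c}"
    using \<open>c \<in> M\<close> by (simp add: M_def)
  ultimately show ?thesis
    by (rule that)
qed

lemma finite_median_exists:
  fixes f :: "'a \<Rightarrow> 'b::linorder"
  assumes "finite V"
  obtains c where "2 * card {v \<in> V. f v < c} \<le> card V" "2 * card {v \<in> V. c < f v} \<le> card V"
proof (cases "V = {}")
  case True
  then show ?thesis
    using that by simp
next
  case False
  define k where "k = (card V + 1) div 2"
  have "0 < card V"
    using assms False by (simp add: card_gt_0_iff)
  then have "0 < k" "k \<le> card V"
    by (simp_all add: k_def)
  then obtain c where c: "card {v \<in> V. f v < c} < k" "k \<le> card {v \<in> V. f v \<le> c}"
    by (rule order_statistic_exists)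
  have "{v \<in> V. c < f v} = V - {v \<in> V. f v \<le> c}"
    by auto
  then have "card {v \<in> V. c < f v} = card V - card {v \<in> V. f v \<le> c}"
    using assms by (simp add: card_Diff_subset)
  with c have "2 * card {v \<in> V. f v < c} \<le> card V" "2 * card {v \<in> V. c < f v} \<le> card V"
    unfolding k_def by linarith+
  then show ?thesis
    by (rule that)
qed

lemma balanced_separator_stabbed_intervals:
  fixes l u :: "'a \<Rightarrow> 'c::linorder"
  assumes fin: "finite (verts G)"
    and nonempty: "\<And>v. v \<in> verts G \<Longrightarrow> l v \<le> u v"
    and overlap: "\<And>v w. v \<rightarrow>\<^bsub>G\<^esub> w \<Longrightarrow> l v \<le> u w \<and> l w \<le> u v"
  obtains c where "balanced_separator G {v \<in> verts G. l v \<le> c \<and> c \<le> u v}"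
proof -
  obtain c where c: "2 * card {v \<in> verts G. l v < c} \<le> card (verts G)"
    "2 * card {v \<in> verts G. c < l v} \<le> card (verts G)"
    by (rule finite_median_exists[OF fin])
  define A where "A = {v \<in> verts G. u v < c}"
  define B where "B = {v \<in> verts G. c < l v}"
  have "card A \<le> card {v \<in> verts G. l v < c}"
    using fin nonempty by (intro card_mono) (auto simp: A_def intro: le_less_trans)
  with c have "int (card A) \<le> \<lceil>real (card (verts G)) / 2\<rceil>"
    "int (card B) \<le> \<lceil>real (card (verts G)) / 2\<rceil>"
    unfolding B_def by linarith+
  moreover have "A \<union> B = verts G - {v \<in> verts G. l v \<le> c \<and> c \<le> u v}"
    by (auto simp: A_def B_def)
  moreover have "A \<inter> B = {}"
    using nonempty by (fastforce simp: A_def B_def)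
  moreover have "\<not> a \<rightarrow>\<^bsub>G\<^esub> b \<and> \<not> b \<rightarrow>\<^bsub>G\<^esub> a" if "a \<in> A" "b \<in> B" for a b
    using overlap[of a b] overlap[of b a] that by (auto simp: A_def B_def)
  ultimately have "balanced_separator G {v \<in> verts G. l v \<le> c \<and> c \<le> u v}"
    unfolding balanced_separator_def by (intro conjI exI[of _ A] exI[of _ B]) auto
  then show ?thesis
    by (rule that)
qed

lemma cball_Int_cball_nonempty_iff:
  fixes a b :: "'a::real_normed_vector"
  assumes "0 \<le> r" "0 \<le> s"
  shows "cball a r \<inter> cball b s \<noteq> {} \<longleftrightarrow> dist a b \<le> r + s"
proof
  show "dist a b \<le> r + s" if "cball a r \<inter> cball b s \<noteq> {}"
    using that disjoint_cballI[of r s a b] by force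
next
  assume close: "dist a b \<le> r + s"
  show "cball a r \<inter> cball b s \<noteq> {}"
  proof (cases "dist a b \<le> r")
    case True
    then have "b \<in> cball a r \<inter> cball b s"
      using assms by simp
    then show ?thesis
      by blast
  next
    case False
    define t where "t = r / dist a b"
    define p where "p = a + t *\<^sub>R (b - a)"
    have t: "0 \<le> t" "t \<le> 1" "t * dist a b = r"
      using False assms by (auto simp: t_def divide_le_eq)
    have "a - p = - (t *\<^sub>R (b - a))" "b - p = (1 - t) *\<^sub>R (b - a)"
      by (simp_all add: p_def algebra_simps)
    then have "dist a p = t * dist a b" "dist b p = (1 - t) * dist a b"
      using t by (simp_all add: dist_norm norm_minus_commute)
    then have "p \<in> cball a r \<inter> cball b s"
      using t close by (simp add: left_diff_distrib)
    then show ?thesis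
      by blast
  qed
qed

lemma cball_Int_hyperplane_nonempty_iff:
  fixes n :: "'a::real_inner"
  assumes "norm n = 1"
  shows "cball p r \<inter> {q. n \<bullet> q = c} \<noteq> {} \<longleftrightarrow> \<bar>n \<bullet> p - c\<bar> \<le> r"
proof
  assume "cball p r \<inter> {q. n \<bullet> q = c} \<noteq> {}"
  then obtain q where q: "q \<in> cball p r" "n \<bullet> q = c"
    by blast
  have "\<bar>n \<bullet> (p - q)\<bar> \<le> dist p q"
    using Cauchy_Schwarz_ineq2[of n "p - q"] assms by (simp add: dist_norm)
  with q show "\<bar>n \<bullet> p - c\<bar> \<le> r"
    by (simp add: inner_diff_right)
next
  assume "\<bar>n \<bullet> p - c\<bar> \<le> r"
  moreover have "n \<bullet> n = 1"
    using assms by (simp add: norm_eq_1)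
  ultimately have "p - (n \<bullet> p - c) *\<^sub>R n \<in> cball p r \<inter> {q. n \<bullet> q = c}"
    using assms by (simp add: dist_norm inner_diff_right)
  then show "cball p r \<inter> {q. n \<bullet> q = c} \<noteq> {}"
    by blast
qed

lemma affine_codim_1_iff_unit_normal:
  fixes S :: "'a::euclidean_space set"
  shows "affine S \<and> aff_dim S = DIM('a) - 1 \<longleftrightarrow> (\<exists>n c. norm n = 1 \<and> S = {x. n \<bullet> x = c})"
proof
  assume codim: "affine S \<and> aff_dim S = DIM('a) - 1"
  then obtain a b where a: "a \<noteq> 0" and "affine hull S = {x. a \<bullet> x = b}"
    using aff_dim_eq_hyperplane[of S] by blast
  with codim have S: "S = {x. a \<bullet> x = b}"
    by (simp add: hull_same)
  have "(a /\<^sub>R norm a) \<bullet> x = (a \<bullet> x) / norm a" for x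
    by (simp only: inner_scaleR_left divide_inverse_commute)
  with a S have "S = {x. (a /\<^sub>R norm a) \<bullet> x = b / norm a}"
    by simp
  moreover have "norm (a /\<^sub>R norm a) = 1"
    using a by simp
  ultimately show "\<exists>n c. norm n = 1 \<and> S = {x. n \<bullet> x = c}"
    by blast
next
  assume "\<exists>n c. norm n = 1 \<and> S = {x. n \<bullet> x = c}"
  then obtain n c where "norm n = 1" and S: "S = {x. n \<bullet> x = c}"
    by blast
  then have "n \<noteq> 0"
    by auto
  with S show "affine S \<and> aff_dim S = DIM('a) - 1"
    by (simp add: affine_hyperplane)
qed

lemma is_line_iff_unit_normal:
  "is_line L \<longleftrightarrow> (\<exists>n c. norm n = 1 \<and> L = {p. n \<bullet> p = c})"
  unfolding is_line_def using affine_codim_1_iff_unit_normal[of L] by simp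

definition perp :: "real \<times> real \<Rightarrow> real \<times> real" where
  "perp n = (snd n, - fst n)"

lemma norm_perp [simp]: "norm (perp n) = norm n"
  by (simp add: perp_def norm_prod_def add.commute)

lemma norm_Pair_inner_perp: "norm (perp n \<bullet> z, n \<bullet> z) = norm n * norm z"
proof -
  have "(perp n \<bullet> z)\<^sup>2 + (n \<bullet> z)\<^sup>2 = ((fst n)\<^sup>2 + (snd n)\<^sup>2) * ((fst z)\<^sup>2 + (snd z)\<^sup>2)"
    by (simp add: perp_def inner_prod_def) algebra
  then show ?thesis
    by (simp add: norm_prod_def real_sqrt_mult)
qed

lemma dominates_induce_subgraph_iff:
  "u \<rightarrow>\<^bsub>G \<restriction> S\<^esub> v \<longleftrightarrow> u \<in> S \<and> v \<in> S \<and> u \<rightarrow>\<^bsub>G\<^esub> v"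
  by (auto simp: arcs_ends_def arc_to_ends_def)

lemma (in graph) graph_induce_subgraph:
  assumes "S \<subseteq> verts G"
  shows "graph (G \<restriction> S)"
proof -
  have "induced_subgraph (G \<restriction> S) G"
    using assms by (rule induced_induce)
  then have "digraph (G \<restriction> S)" "sym_digraph (G \<restriction> S)"
    by (rule digraphI_induced, rule induced_graph_imp_graph)
  then show ?thesis
    by (simp add: graph_def pseudo_graph_def digraph_def)
qed

lemma disk_representation_iff_dist:
  "disk_representation G x y r \<longleftrightarrow>
     (\<forall>v\<in>verts G. 0 < r v) \<and>
     (\<forall>u\<in>verts G. \<forall>v\<in>verts G. u \<noteq> v \<longrightarrow>
        (u \<rightarrow>\<^bsub>G\<^esub> v \<longleftrightarrow> dist (x u, y u) (x v, y v) \<le> r u + r v))"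
  unfolding disk_representation_def
  by (intro conj_cong refl ball_cong imp_cong)
    (simp add: cball_Int_cball_nonempty_iff less_imp_le)

lemma disk_representation_isometric:
  assumes "disk_representation G x y r"
    and "\<And>u v. u \<in> verts G \<Longrightarrow> v \<in> verts G \<Longrightarrow>
      dist (x' u, y' u) (x' v, y' v) = dist (x u, y u) (x v, y v)"
  shows "disk_representation G x' y' r"
  using assms by (simp add: disk_representation_iff_dist)

lemma disk_representation_induce_subgraph:
  assumes "disk_representation G x y r" "S \<subseteq> verts G"
  shows "disk_representation (G \<restriction> S) x y r"
  using assms unfolding disk_representation_def
  by (auto simp: dominates_induce_subgraph_iff subset_iff)

definition disks_meeting ::
  "('a, 'b) pre_digraph \<Rightarrow> ('a \<Rightarrow> real) \<Rightarrow> ('a \<Rightarrow> real) \<Rightarrow> ('a \<Rightarrow> real) \<Rightarrow>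
    (real \<times> real) set \<Rightarrow> 'a set" where
  "disks_meeting G x y r L = {v \<in> verts G. cball (x v, y v) (r v) \<inter> L \<noteq> {}}"

lemma disks_meeting_line_eq:
  assumes "norm n = 1"
  shows "disks_meeting G x y r {q. n \<bullet> q = c} = {v \<in> verts G. \<bar>n \<bullet> (x v, y v) - c\<bar> \<le> r v}"
  unfolding disks_meeting_def cball_Int_hyperplane_nonempty_iff[OF assms] ..

lemma balanced_separator_disks_meeting_line:
  assumes "graph G" and rep: "disk_representation G x y r" and "norm n = 1"
  obtains c where "balanced_separator G (disks_meeting G x y r {q. n \<bullet> q = c})"
proof -
  interpret graph G by fact
  define l where "l v = n \<bullet> (x v, y v) - r v" for v
  define u where "u v = n \<bullet> (x v, y v) + r v" for v
  have projection: "l v \<le> n \<bullet> q \<and> n \<bullet> q \<le> u v" if "q \<in> cball (x v, y v) (r v)" for q v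
    using cball_Int_hyperplane_nonempty_iff[OF \<open>norm n = 1\<close>, of "(x v, y v)" "r v" "n \<bullet> q"] that
    by (auto simp: l_def u_def)
  have "l v \<le> u v" if "v \<in> verts G" for v
    using rep that by (auto simp: disk_representation_def l_def u_def less_imp_le)
  moreover have "l v \<le> u w \<and> l w \<le> u v" if "v \<rightarrow>\<^bsub>G\<^esub> w" for v w
  proof -
    have "v \<in> verts G" "w \<in> verts G" "v \<noteq> w"
      using that adj_in_verts adj_not_same by blast+
    with that rep have "cball (x v, y v) (r v) \<inter> cball (x w, y w) (r w) \<noteq> {}"
      unfolding disk_representation_def by blast
    then obtain q where "q \<in> cball (x v, y v) (r v)" "q \<in> cball (x w, y w) (r w)"
      by blast
    then show ?thesis
      using projection[of q v] projection[of q w] by linarith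
  qed
  ultimately obtain c where "balanced_separator G {v \<in> verts G. l v \<le> c \<and> c \<le> u v}"
    by (rule balanced_separator_stabbed_intervals[OF finite_verts])
  moreover have "disks_meeting G x y r {q. n \<bullet> q = c} = {v \<in> verts G. l v \<le> c \<and> c \<le> u v}"
    by (auto simp: disks_meeting_line_eq[OF \<open>norm n = 1\<close>] l_def u_def)
  ultimately show ?thesis
    by (intro that[of c]) simp
qed

lemma linear_disk_graph_disks_meeting:
  assumes "graph G" "disk_representation G x y r" "is_line L"
  shows "linear_disk_graph (G \<restriction> disks_meeting G x y r L)"
proof -
  have "disks_meeting G x y r L \<subseteq> verts G"
    by (auto simp: disks_meeting_def)
  with assms have "graph (G \<restriction> disks_meeting G x y r L)"
    "disk_representation (G \<restriction> disks_meeting G x y r L) x y r"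
    by (auto intro: graph.graph_induce_subgraph disk_representation_induce_subgraph)
  with \<open>is_line L\<close> show ?thesis
    unfolding linear_disk_graph_def
    by (intro conjI exI[of _ x] exI[of _ y] exI[of _ r] exI[of _ L])
      (simp_all add: disks_meeting_def)
qed

lemma disk_graph_separator:
  assumes "disk_graph G"
  obtains S where "balanced_separator G S" "linear_disk_graph (G \<restriction> S)"
proof -
  obtain x y r where G: "graph G" "disk_representation G x y r"
    using assms unfolding disk_graph_def by blast
  obtain n :: "real \<times> real" where n: "norm n = 1"
    using vector_choose_size[of 1] zero_le_one by blast
  then obtain c where "balanced_separator G (disks_meeting G x y r {q. n \<bullet> q = c})"
    by (rule balanced_separator_disks_meeting_line[OF G])
  moreover have "is_line {q. n \<bullet> q = c}"
    unfolding is_line_iff_unit_normal using n by blast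
  then have "linear_disk_graph (G \<restriction> disks_meeting G x y r {q. n \<bullet> q = c})"
    by (rule linear_disk_graph_disks_meeting[OF G])
  ultimately show ?thesis
    by (rule that)
qed

lemma linear_disk_graph_crossing_axes:
  assumes "linear_disk_graph G"
  obtains x y r where "disk_representation G x y r" "\<And>v. v \<in> verts G \<Longrightarrow> \<bar>y v\<bar> \<le> r v"
    "balanced_separator G {v \<in> verts G. \<bar>x v\<bar> \<le> r v}"
proof -
  obtain x y r L where "graph G" and rep: "disk_representation G x y r" and "is_line L"
    and meets: "\<And>v. v \<in> verts G \<Longrightarrow> cball (x v, y v) (r v) \<inter> L \<noteq> {}"
    using assms unfolding linear_disk_graph_def by blast
  obtain n c where n: "norm n = 1" and L: "L = {p. n \<bullet> p = c}"
    using \<open>is_line L\<close> unfolding is_line_iff_unit_normal by blast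
  obtain d where sep: "balanced_separator G (disks_meeting G x y r {q. perp n \<bullet> q = d})"
    using balanced_separator_disks_meeting_line[OF \<open>graph G\<close> rep, of "perp n"] n by auto
  define p where "p v = (x v, y v)" for v
  define x' where "x' v = perp n \<bullet> p v - d" for v
  define y' where "y' v = n \<bullet> p v - c" for v
  have "disk_representation G x' y' r"
  proof (rule disk_representation_isometric[OF rep])
    fix u v
    have "(x' u, y' u) - (x' v, y' v) = (perp n \<bullet> (p u - p v), n \<bullet> (p u - p v))"
      by (simp add: x'_def y'_def inner_diff_right)
    then have "dist (x' u, y' u) (x' v, y' v) = dist (p u) (p v)"
      by (simp only: dist_norm norm_Pair_inner_perp n mult_1)
    then show "dist (x' u, y' u) (x' v, y' v) = dist (x u, y u) (x v, y v)"
      by (simp only: p_def)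
  qed
  moreover have "\<bar>y' v\<bar> \<le> r v" if "v \<in> verts G" for v
    using meets[OF that] n by (simp add: L y'_def p_def cball_Int_hyperplane_nonempty_iff)
  moreover have "balanced_separator G {v \<in> verts G. \<bar>x' v\<bar> \<le> r v}"
    using sep n by (simp add: disks_meeting_line_eq x'_def p_def)
  ultimately show ?thesis
    by (rule that)
qed

lemma abs_diff_abs_eq_if_same_sign:
  fixes a b :: "'a::linordered_idom"
  assumes "0 < a \<longleftrightarrow> 0 < b"
  shows "\<bar>\<bar>a\<bar> - \<bar>b\<bar>\<bar> = \<bar>a - b\<bar>"
  using assms by (cases "0 < a") auto

lemma Delta_disk_graph_same_quadrant:
  assumes "graph G" and rep: "disk_representation G x y r" and "V \<subseteq> verts G"
    and same_quadrant: "\<And>u v. u \<in> V \<Longrightarrow> v \<in> V \<Longrightarrow> (0 < x u \<longleftrightarrow> 0 < x v) \<and> (0 < y u \<longleftrightarrow> 0 < y v)"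
    and axes: "\<And>v. v \<in> V \<Longrightarrow> \<bar>x v\<bar> \<le> r v \<and> \<bar>y v\<bar> \<le> r v"
    and origin: "\<And>v. v \<in> V \<Longrightarrow> r v < norm (x v, y v)"
  shows "Delta_disk_graph (G \<restriction> V)"
proof -
  have "disk_representation (G \<restriction> V) x y r"
    using rep \<open>V \<subseteq> verts G\<close> by (rule disk_representation_induce_subgraph)
  then have "disk_representation (G \<restriction> V) (\<lambda>v. \<bar>x v\<bar>) (\<lambda>v. \<bar>y v\<bar>) r"
  proof (rule disk_representation_isometric)
    fix u v
    assume "u \<in> verts (G \<restriction> V)" "v \<in> verts (G \<restriction> V)"
    then show "dist (\<bar>x u\<bar>, \<bar>y u\<bar>) (\<bar>x v\<bar>, \<bar>y v\<bar>) = dist (x u, y u) (x v, y v)"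
      using same_quadrant[of u v] by (simp add: dist_Pair_Pair dist_real_def abs_diff_abs_eq_if_same_sign)
  qed
  moreover have "x v \<noteq> 0" "y v \<noteq> 0" if "v \<in> V" for v
    using axes[OF that] origin[OF that] by (auto simp: norm_prod_def)
  ultimately show ?thesis
    unfolding Delta_disk_graph_def
    using axes origin graph.graph_induce_subgraph[OF \<open>graph G\<close> \<open>V \<subseteq> verts G\<close>]
    by (intro conjI exI[of _ "\<lambda>v. \<bar>x v\<bar>"] exI[of _ "\<lambda>v. \<bar>y v\<bar>"] exI[of _ r])
      (auto simp: norm_prod_def)
qed

lemma complete_digraph_common_point:
  assumes "graph G" and rep: "disk_representation G x y r" and "V \<subseteq> verts G"
    and common: "\<And>v. v \<in> V \<Longrightarrow> p \<in> cball (x v, y v) (r v)"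
  shows "complete_digraph (card V) (G \<restriction> V)"
proof -
  interpret graph "G \<restriction> V"
    using assms(1,3) by (rule graph.graph_induce_subgraph)
  have "u \<rightarrow>\<^bsub>G \<restriction> V\<^esub> v \<longleftrightarrow> u \<in> V \<and> v \<in> V \<and> u \<noteq> v" for u v
  proof
    show "u \<in> V \<and> v \<in> V \<and> u \<noteq> v" if "u \<rightarrow>\<^bsub>G \<restriction> V\<^esub> v"
      using that adj_in_verts adj_not_same by fastforce
    show "u \<rightarrow>\<^bsub>G \<restriction> V\<^esub> v" if "u \<in> V \<and> v \<in> V \<and> u \<noteq> v"
      using that disk_representation_induce_subgraph[OF rep \<open>V \<subseteq> verts G\<close>] common
      unfolding disk_representation_def by (metis IntI empty_iff induce_subgraph_verts)
  qed
  then show ?thesis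
    using graph_axioms by (auto simp: complete_digraph_def simp del: mem_Collect_eq)
qed

definition quadrant :: "real \<times> real \<Rightarrow> nat" where
  "quadrant p = (if 0 < fst p then (if 0 < snd p then 1 else 4) else (if 0 < snd p then 2 else 3))"

lemma quadrant_in_range: "quadrant p \<in> {1..4}"
  by (simp add: quadrant_def)

lemma quadrant_eq_iff:
  "quadrant p = quadrant q \<longleftrightarrow> (0 < fst p \<longleftrightarrow> 0 < fst q) \<and> (0 < snd p \<longleftrightarrow> 0 < snd q)"
  by (simp add: quadrant_def)

lemma disks_crossing_axes_partition:
  fixes G :: "('a, 'b) pre_digraph"
  assumes "graph G" "disk_representation G x y r" "S \<subseteq> verts G"
    and axes: "\<And>v. v \<in> S \<Longrightarrow> \<bar>x v\<bar> \<le> r v \<and> \<bar>y v\<bar> \<le> r v"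
  shows "\<exists>V :: nat \<Rightarrow> 'a set. (\<Union>i\<in>{1..5}. V i) = S \<and> disjoint_family_on V {1..5} \<and>
    (\<forall>i\<in>{1..4}. Delta_disk_graph (G \<restriction> V i)) \<and>
    complete_digraph (card (V 5)) (G \<restriction> V 5)"
proof -
  define index where
    "index v = (if norm (x v, y v) \<le> r v then 5 else quadrant (x v, y v))" for v
  define V where "V i = {v \<in> S. index v = i}" for i
  have V: "V i \<subseteq> verts G" for i
    using \<open>S \<subseteq> verts G\<close> by (auto simp: V_def)
  have "index v \<in> {1..5}" for v
    using quadrant_in_range[of "(x v, y v)"] by (auto simp: index_def)
  then have "(\<Union>i\<in>{1..5}. V i) = S"
    by (auto simp: V_def)
  moreover have "disjoint_family_on V {1..5}"
    by (auto simp: disjoint_family_on_def V_def)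
  moreover have "Delta_disk_graph (G \<restriction> V i)" if "i \<in> {1..4}" for i
  proof (rule Delta_disk_graph_same_quadrant[OF assms(1,2) V])
    have off_origin: "r v < norm (x v, y v) \<and> quadrant (x v, y v) = i" if "v \<in> V i" for v
      using that \<open>i \<in> {1..4}\<close> by (auto simp: V_def index_def split: if_splits)
    then show "r v < norm (x v, y v)" if "v \<in> V i" for v
      using that by blast
    show "(0 < x u \<longleftrightarrow> 0 < x v) \<and> (0 < y u \<longleftrightarrow> 0 < y v)" if "u \<in> V i" "v \<in> V i" for u v
      using that[THEN off_origin] quadrant_eq_iff[of "(x u, y u)" "(x v, y v)"] by simp
    show "\<bar>x v\<bar> \<le> r v \<and> \<bar>y v\<bar> \<le> r v" if "v \<in> V i" for v
      using that axes by (simp add: V_def)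
  qed
  moreover have "0 \<in> cball (x v, y v) (r v)" if "v \<in> V 5" for v
    using that quadrant_in_range[of "(x v, y v)"] by (auto simp: V_def index_def split: if_splits)
  then have "complete_digraph (card (V 5)) (G \<restriction> V 5)"
    by (rule complete_digraph_common_point[OF assms(1,2) V])
  ultimately show ?thesis
    by blast
qed

theorem theorem17:
  shows "(\<forall>G :: ('a, 'b) pre_digraph. disk_graph G \<longrightarrow>
            (\<exists>S. balanced_separator G S \<and> linear_disk_graph (G \<restriction> S))) \<and>
         (\<forall>G :: ('a, 'b) pre_digraph. linear_disk_graph G \<longrightarrow>
            (\<exists>S. balanced_separator G S \<and>
               (\<exists>V :: nat \<Rightarrow> 'a set.
                  (\<Union>i\<in>{1..5}. V i) = S \<and> disjoint_family_on V {1..5} \<and>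
                  (\<forall>i\<in>{1..4}. Delta_disk_graph (G \<restriction> V i)) \<and>
                  complete_digraph (card (V 5)) (G \<restriction> V 5))))"
proof (intro conjI allI impI)
  fix G :: "('a, 'b) pre_digraph"
  assume "disk_graph G"
  then show "\<exists>S. balanced_separator G S \<and> linear_disk_graph (G \<restriction> S)"
    by (meson disk_graph_separator)
next
  fix G :: "('a, 'b) pre_digraph"
  assume linear: "linear_disk_graph G"
  then have "graph G"
    by (simp add: linear_disk_graph_def)
  obtain x y r where rep: "disk_representation G x y r"
    and "\<And>v. v \<in> verts G \<Longrightarrow> \<bar>y v\<bar> \<le> r v"
    and "balanced_separator G {v \<in> verts G. \<bar>x v\<bar> \<le> r v}" (is "balanced_separator G ?S")
    using linear_disk_graph_crossing_axes[OF linear] by blast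
  then show "\<exists>S. balanced_separator G S \<and> (\<exists>V :: nat \<Rightarrow> 'a set.
      (\<Union>i\<in>{1..5}. V i) = S \<and> disjoint_family_on V {1..5} \<and>
      (\<forall>i\<in>{1..4}. Delta_disk_graph (G \<restriction> V i)) \<and> complete_digraph (card (V 5)) (G \<restriction> V 5))"
    by (intro exI[of _ ?S] conjI disks_crossing_axes_partition[OF \<open>graph G\<close> rep]) auto
qed

end
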